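(* Fix $0<q<1$. For each $n\ge 1$ let $L^{\downarrow}_n=L^{\downarrow}_n(q)$ denote the length of a longest decreasing subsequence of a random $\mathrm{Mallows}(q)$ permutation of $[n]$. Then $$\frac{L^{\downarrow}_n\sqrt{\log q^{-1}}}{\sqrt{2\log n}}\to 1$$ in probability as $n\to\infty$.
   Context: $[n]=\{1,\dots,n\}$ and $\mathcal S_n$ is the set of permutations of $[n]$. For $\pi\in\mathcal S_n$, $\mathrm{inv}(\pi)=\#\{(i,j):1\le i<j\le n,\ \pi(i)>\pi(j)\}$. A random permutation $\Pi$ of $[n]$ is $\mathrm{Mallows}(q)$ ($q>0$) if $\mathbb P(\Pi=\pi)=q^{\mathrm{inv}(\pi)}/Z_{n,q}$ for every $\pi\in\mathcal S_n$, where $Z_{n,q}=\sum_{\pi\in\mathcal S_n}q^{\mathrm{inv}(\pi)}$. A decreasing subsequence of $\pi$ of length $k$ is a sequence $1\le i_1<\dots<i_k\le n$ with $\pi(i_1)>\dots>\pi(i_k)$; a longest decreasing subsequence is one of maximum length. *)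

theory Defs
  imports "HOL-Probability.Probability" "HOL-Combinatorics.Permutations"
begin

text \<open>A permutation of $[n]$ is a function \<open>nat \<Rightarrow> nat\<close> that permutes \<open>{1..n}\<close>; by the library's
  definition of \<open>permutes\<close> it is the identity outside \<open>{1..n}\<close>.\<close>

definition perms :: "nat \<Rightarrow> (nat \<Rightarrow> nat) set" where
  "perms n = {\<pi>. \<pi> permutes {1..n}}"

definition inversions :: "nat \<Rightarrow> (nat \<Rightarrow> nat) \<Rightarrow> nat" where
  "inversions n \<pi> = card {(i, j). 1 \<le> i \<and> i < j \<and> j \<le> n \<and> \<pi> i > \<pi> j}"

definition mallows_Z :: "nat \<Rightarrow> real \<Rightarrow> real" where
  "mallows_Z n q = (\<Sum>\<pi>\<in>perms n. q ^ inversions n \<pi>)"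

definition mallows_permutation ::
  "'w measure \<Rightarrow> ('w \<Rightarrow> nat \<Rightarrow> nat) \<Rightarrow> nat \<Rightarrow> real \<Rightarrow> bool" where
  "mallows_permutation M X n q \<longleftrightarrow>
     prob_space M \<and>
     X \<in> measurable M (count_space (perms n)) \<and>
     (\<forall>\<pi>\<in>perms n. measure M {\<omega> \<in> space M. X \<omega> = \<pi>} = q ^ inversions n \<pi> / mallows_Z n q)"

text \<open>A decreasing subsequence is given by its list of positions.\<close>

definition decreasing_subseq :: "nat \<Rightarrow> (nat \<Rightarrow> nat) \<Rightarrow> nat list \<Rightarrow> bool" where
  "decreasing_subseq n \<pi> is \<longleftrightarrow>
     set is \<subseteq> {1..n} \<and> sorted_wrt (<) is \<and> sorted_wrt (>) (map \<pi> is)"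

definition longest_decreasing :: "nat \<Rightarrow> (nat \<Rightarrow> nat) \<Rightarrow> nat" where
  "longest_decreasing n \<pi> = Max {length is |is. decreasing_subseq n \<pi> is}"

text \<open>The variables may live on different probability spaces. The events below are measurable as
  soon as the \<open>Y n\<close> are; see \<open>mallows_permutation_borel_measurable\<close>.\<close>

definition tendsto_in_prob ::
  "(nat \<Rightarrow> 'w measure) \<Rightarrow> (nat \<Rightarrow> 'w \<Rightarrow> real) \<Rightarrow> real \<Rightarrow> bool" where
  "tendsto_in_prob M Y c \<longleftrightarrow>
     (\<forall>\<epsilon>>0. (\<lambda>n. measure (M n) {\<omega> \<in> space (M n). \<bar>Y n \<omega> - c\<bar> > \<epsilon>}) \<longlonglongrightarrow> 0)"

lemma finite_decreasing_subseq_lengths: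
  "finite {length is |is. decreasing_subseq n \<pi> is}"
proof (rule finite_subset)
  show "{length is |is. decreasing_subseq n \<pi> is} \<subseteq> {..n}"
  proof safe
    fix "is" assume *: "decreasing_subseq n \<pi> is"
    then have "length is = card (set is)"
      by (auto simp: decreasing_subseq_def strict_sorted_iff distinct_card)
    also have "\<dots> \<le> card {1..n}"
      using * by (intro card_mono) (auto simp: decreasing_subseq_def)
    finally show "length is \<le> n" by simp
  qed
qed simp

lemma decreasing_subseq_lengths_nonempty:
  "{length is |is. decreasing_subseq n \<pi> is} \<noteq> {}"
  by (auto simp: decreasing_subseq_def intro!: exI[of _ "[]"])

lemma mallows_permutation_borel_measurable:
  fixes f :: "(nat \<Rightarrow> nat) \<Rightarrow> real"
  assumes "mallows_permutation M X n q"
  shows "(\<lambda>\<omega>. f (X \<omega>)) \<in> borel_measurable M"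
proof -
  have "X \<in> measurable M (count_space (perms n))"
    using assms by (simp add: mallows_permutation_def)
  then show ?thesis by (rule measurable_compose) simp
qed

lemma finite_perms: "finite (perms n)"
  by (simp add: perms_def finite_permutations)

lemma mallows_Z_pos:
  assumes "q > 0"
  shows "mallows_Z n q > 0"
  unfolding mallows_Z_def
  using assms
  by (intro sum_pos) (auto simp: perms_def finite_permutations intro: permutes_id)

lemma mallows_permutation_exists:
  assumes "q > 0"
  shows "\<exists>M. mallows_permutation M (\<lambda>\<pi>. \<pi>) n q"
proof -
  define p where "p = (\<lambda>\<pi>. q ^ inversions n \<pi> / mallows_Z n q)"
  define M where "M = point_measure (perms n) p"
  have p: "p \<pi> \<ge> 0" for \<pi>
    using assms mallows_Z_pos[OF assms, of n] by (simp add: p_def)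
  have "sum p (perms n) = 1"
    using mallows_Z_pos[OF assms, of n]
    by (simp add: p_def mallows_Z_def flip: sum_divide_distrib)
  then have "prob_space M"
    unfolding M_def using p
    by (intro prob_space_point_measure) (auto simp: finite_perms)
  moreover have "(\<lambda>\<pi>. \<pi>) \<in> measurable M (count_space (perms n))"
    by (simp add: M_def)
  moreover have "measure M {\<omega> \<in> space M. \<omega> = \<pi>} = p \<pi>" if "\<pi> \<in> perms n" for \<pi>
  proof -
    have "{\<omega> \<in> space M. \<omega> = \<pi>} = {\<pi>}"
      using that by (auto simp: M_def space_point_measure)
    then show ?thesis
      using that p by (simp add: M_def measure_def emeasure_point_measure_finite finite_perms)
  qed
  ultimately show ?thesis
    by (auto simp: mallows_permutation_def p_def)
qed

end

theory Submission
  imports Defs "HOL-Real_Asymp.Real_Asymp"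
begin

text \<open>
  The Lehmer code, which records at position $i$ the number $c_i$ of $j > i$ with
  $\pi(j) < \pi(i)$, maps the permutations of $[n]$ bijectively onto $\prod_i \{0,\dots,n-i\}$, and
  the number of inversions is $\sum_i c_i$. Under the Mallows measure the $c_i$ are therefore
  independent truncated geometric variables.

  Upper bound: if $\pi$ is decreasing on a set $S$ of size $k$, then $c_i$ is at least the number of
  elements of $S$ above $i$, for every $i \in S$; this has probability at most $q^{k(k-1)/2}$.
  If the codes of $\pi$ and of $\pi^{-1}$ are everywhere smaller than $D$, inverted positions are
  less than $2D$ apart, so only $n \binom{2D}{k}$ sets $S$ matter. With $D$ of order $\log n$ the
  union bound is $n^{1+o(1)} q^{k^2/2}$.

  Lower bound: $\pi$ is decreasing on a block of $k$ consecutive positions as soon as the code reads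
  $k-1, k-2, \dots, 0$ there, which has probability at least $(1-q)^k q^{k(k-1)/2}$. There are
  $\lfloor n/k \rfloor$ disjoint blocks, and they are independent.

  Both bounds change from trivial to vanishing at $k \sim \sqrt{2 \log n / \log q^{-1}}$.
\<close>

section \<open>The Lehmer code\<close>

definition lehmer :: "nat \<Rightarrow> (nat \<Rightarrow> nat) \<Rightarrow> nat \<Rightarrow> nat" where
  "lehmer n \<pi> = (\<lambda>i\<in>{1..n}. card {j\<in>{1..n}. i < j \<and> \<pi> j < \<pi> i})"

definition codes :: "nat \<Rightarrow> (nat \<Rightarrow> nat) set" where
  "codes n = (\<Pi>\<^sub>E i\<in>{1..n}. {..n - i})"

lemma permutes_mem: "\<pi> permutes A \<Longrightarrow> i \<in> A \<Longrightarrow> \<pi> i \<in> A"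
  by (simp add: permutes_in_image)

text \<open>\<open>\<pi>\<close> carries the positions counted by the code at \<open>i\<close> onto
  the smaller values that no earlier position has used. In this form the code at \<open>i\<close>
  depends only on \<open>\<pi>\<close> up to \<open>i\<close>.\<close>

lemma lehmer_eq_card_values:
  assumes "\<pi> permutes {1..n}" "i \<in> {1..n}"
  shows "lehmer n \<pi> i = card ({1..<\<pi> i} - \<pi> ` {1..<i})"
proof -
  let ?J = "{j\<in>{1..n}. i < j \<and> \<pi> j < \<pi> i}"
  have inj: "inj \<pi>" using assms(1) by (rule permutes_inj)
  have "\<pi> ` ?J = {1..<\<pi> i} - \<pi> ` {1..<i}"
  proof (intro equalityI subsetI)
    fix v assume "v \<in> \<pi> ` ?J"
    then obtain j where j: "j \<in> ?J" "v = \<pi> j" by auto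
    then have "\<pi> j \<in> {1..n}" using permutes_mem[OF assms(1)] by simp
    with j show "v \<in> {1..<\<pi> i} - \<pi> ` {1..<i}"
      using inj by (auto simp: inj_eq)
  next
    fix v assume v: "v \<in> {1..<\<pi> i} - \<pi> ` {1..<i}"
    have "\<pi> i \<in> {1..n}" using permutes_mem[OF assms] .
    with v have "v \<in> {1..n}" by auto
    then have "v \<in> \<pi> ` {1..n}" using permutes_image[OF assms(1)] by simp
    then obtain j where j: "j \<in> {1..n}" "v = \<pi> j" by auto
    have "j \<noteq> i" using v j by auto
    moreover have "\<not> j < i" using v j by auto
    ultimately have "j \<in> ?J" using v j by simp
    then show "v \<in> \<pi> ` ?J" using j(2) by blast
  qed
  moreover have "card (\<pi> ` ?J) = card ?J"
    by (intro card_image inj_on_subset[OF inj]) simp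
  ultimately have "card ?J = card ({1..<\<pi> i} - \<pi> ` {1..<i})" by simp
  then show ?thesis using assms(2) by (simp add: lehmer_def)
qed

lemma inj_on_lehmer: "inj_on (lehmer n) (perms n)"
proof (rule inj_onI, rule ccontr)
  fix \<pi> \<sigma> assume *: "\<pi> \<in> perms n" "\<sigma> \<in> perms n" "lehmer n \<pi> = lehmer n \<sigma>" "\<pi> \<noteq> \<sigma>"
  have less: False if p: "\<pi> permutes {1..n}" "\<sigma> permutes {1..n}" "lehmer n \<pi> = lehmer n \<sigma>"
    and i: "\<pi> i < \<sigma> i" "\<forall>j<i. \<pi> j = \<sigma> j" for \<pi> \<sigma> i
  proof -
    have "i \<in> {1..n}"
      using i p by (metis less_irrefl permutes_not_in)
    note e = lehmer_eq_card_values[OF p(1) this] lehmer_eq_card_values[OF p(2) this]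
    have pi1: "\<pi> i \<in> {1..n}" using permutes_mem[OF p(1) \<open>i \<in> {1..n}\<close>] .
    have im: "\<sigma> ` {1..<i} = \<pi> ` {1..<i}" using i by (intro image_cong) auto
    have "\<pi> i \<notin> \<pi> ` {1..<i}"
      using permutes_inj[OF p(1)] by (auto simp: inj_eq)
    then have "\<pi> i \<in> {1..<\<sigma> i} - \<pi> ` {1..<i}" using i(1) pi1 by simp
    moreover have "{1..<\<pi> i} - \<pi> ` {1..<i} \<subseteq> {1..<\<sigma> i} - \<pi> ` {1..<i}"
      using i(1) by (intro Diff_mono) auto
    moreover have "\<pi> i \<notin> {1..<\<pi> i} - \<pi> ` {1..<i}" by simp
    ultimately have "{1..<\<pi> i} - \<pi> ` {1..<i} \<subset> {1..<\<sigma> i} - \<pi> ` {1..<i}"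
      by blast
    then have "card ({1..<\<pi> i} - \<pi> ` {1..<i}) < card ({1..<\<sigma> i} - \<pi> ` {1..<i})"
      by (intro psubset_card_mono) auto
    then show False using e p(3) im by simp
  qed
  define i where "i = (LEAST i. \<pi> i \<noteq> \<sigma> i)"
  have ne: "\<pi> i \<noteq> \<sigma> i" unfolding i_def by (rule LeastI_ex) (use *(4) in blast)
  have eq: "\<forall>j<i. \<pi> j = \<sigma> j" unfolding i_def using not_less_Least by blast
  have "\<pi> permutes {1..n}" "\<sigma> permutes {1..n}" using * by (simp_all add: perms_def)
  then show False
    using less[of \<pi> \<sigma> i] less[of \<sigma> \<pi> i] *(3) eq ne by (metis linorder_neqE_nat)
qed

lemma lehmer_in_codes: "lehmer n \<pi> \<in> codes n"
proof -
  have "card {j\<in>{1..n}. i < j \<and> \<pi> j < \<pi> i} \<le> n - i" for i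
  proof -
    have "card {j\<in>{1..n}. i < j \<and> \<pi> j < \<pi> i} \<le> card {i<..n}"
      by (intro card_mono) auto
    then show ?thesis by simp
  qed
  then show ?thesis by (auto simp: codes_def lehmer_def)
qed

text \<open>Injectivity leaves only a count: position \<open>i\<close> allows
  \<open>n - i + 1\<close> code values, and these numbers multiply to \<open>fact n\<close>.\<close>

lemma bij_betw_lehmer: "bij_betw (lehmer n) (perms n) (codes n)"
proof -
  have "card (codes n) = (\<Prod>i\<in>{1..n}. Suc (n - i))"
    by (simp add: codes_def card_PiE)
  also have "\<dots> = (\<Prod>i\<in>{1..n}. i)"
    by (rule prod.reindex_bij_witness[of _ "\<lambda>i. Suc n - i" "\<lambda>i. Suc n - i"]) auto
  also have "\<dots> = fact n" by (simp add: fact_prod)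
  also have "\<dots> = card (perms n)"
    by (simp add: perms_def card_permutations)
  finally have "card (lehmer n ` perms n) = card (codes n)"
    by (simp add: card_image inj_on_lehmer)
  moreover have "finite (codes n)" by (auto simp: codes_def intro: finite_PiE)
  ultimately have "lehmer n ` perms n = codes n"
    using lehmer_in_codes by (intro card_subset_eq) auto
  then show ?thesis by (simp add: bij_betw_def inj_on_lehmer)
qed

lemma inversions_eq_sum_lehmer: "inversions n \<pi> = (\<Sum>i\<in>{1..n}. lehmer n \<pi> i)"
proof -
  have "{(i, j). 1 \<le> i \<and> i < j \<and> j \<le> n \<and> \<pi> i > \<pi> j}
      = (SIGMA i:{1..n}. {j\<in>{1..n}. i < j \<and> \<pi> j < \<pi> i})" by auto
  then show ?thesis by (simp add: inversions_def lehmer_def)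
qed

section \<open>Mallows probabilities\<close>

text \<open>A finite sum over \<open>perms n\<close> keeps the estimates free of the underlying
  probability spaces, which enter only through \<open>measure_mallows_permutation\<close>.\<close>

definition mallows_prob :: "nat \<Rightarrow> real \<Rightarrow> ((nat \<Rightarrow> nat) \<Rightarrow> bool) \<Rightarrow> real" where
  "mallows_prob n q P = (\<Sum>\<pi>\<in>{\<pi>\<in>perms n. P \<pi>}. q ^ inversions n \<pi>) / mallows_Z n q"

lemma measure_mallows_permutation:
  assumes "mallows_permutation M X n q"
  shows "measure M {\<omega> \<in> space M. P (X \<omega>)} = mallows_prob n q P"
proof -
  interpret prob_space M using assms by (simp add: mallows_permutation_def)
  have X: "X \<in> measurable M (count_space (perms n))"
    using assms by (simp add: mallows_permutation_def)
  have mem: "X \<omega> \<in> perms n" if "\<omega> \<in> space M" for \<omega>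
    using measurable_space[OF X that] by simp
  let ?E = "{\<pi>\<in>perms n. P \<pi>}"
  have sets: "{\<omega> \<in> space M. X \<omega> = \<pi>} \<in> sets M" if "\<pi> \<in> perms n" for \<pi>
  proof -
    have "X -` {\<pi>} \<inter> space M \<in> sets M"
      using X by (rule measurable_sets) (use that in simp)
    also have "X -` {\<pi>} \<inter> space M = {\<omega> \<in> space M. X \<omega> = \<pi>}" by auto
    finally show ?thesis .
  qed
  have "{\<omega> \<in> space M. P (X \<omega>)} = (\<Union>\<pi>\<in>?E. {\<omega> \<in> space M. X \<omega> = \<pi>})"
    using mem by auto
  also have "prob \<dots> = (\<Sum>\<pi>\<in>?E. prob {\<omega> \<in> space M. X \<omega> = \<pi>})"
    using sets by (intro finite_measure_finite_Union) (auto simp: finite_perms disjoint_family_on_def)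
  also have "\<dots> = (\<Sum>\<pi>\<in>?E. q ^ inversions n \<pi> / mallows_Z n q)"
    using assms by (intro sum.cong) (auto simp: mallows_permutation_def)
  finally show ?thesis by (simp add: mallows_prob_def sum_divide_distrib)
qed

lemma mallows_prob_nonneg: "0 < q \<Longrightarrow> 0 \<le> mallows_prob n q P"
  using mallows_Z_pos[of q n] by (simp add: mallows_prob_def sum_nonneg)

lemma mallows_prob_mono:
  fixes q :: real
  assumes "0 < q" "\<And>\<pi>. \<pi> \<in> perms n \<Longrightarrow> P \<pi> \<Longrightarrow> Q \<pi>"
  shows "mallows_prob n q P \<le> mallows_prob n q Q"
  unfolding mallows_prob_def using assms mallows_Z_pos[of q n]
  by (intro divide_right_mono sum_mono2) (auto simp: finite_perms)

lemma mallows_prob_cong: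
  assumes "\<And>\<pi>. \<pi> \<in> perms n \<Longrightarrow> P \<pi> \<longleftrightarrow> Q \<pi>"
  shows "mallows_prob n q P = mallows_prob n q Q"
  unfolding mallows_prob_def using assms
  by (intro arg_cong2[where f="(/)"] sum.cong) auto

lemma mallows_prob_disj_le:
  fixes q :: real
  assumes "0 < q"
  shows "mallows_prob n q (\<lambda>\<pi>. P \<pi> \<or> Q \<pi>) \<le> mallows_prob n q P + mallows_prob n q Q"
  using assms mallows_Z_pos[of q n]
  unfolding mallows_prob_def add_divide_distrib[symmetric] sum.inter_filter[OF finite_perms]
    sum.distrib[symmetric]
  by (intro divide_right_mono sum_mono) auto

lemma mallows_prob_bex_le:
  fixes q :: real
  assumes "0 < q" "finite F"
  shows "mallows_prob n q (\<lambda>\<pi>. \<exists>x\<in>F. P x \<pi>) \<le> (\<Sum>x\<in>F. mallows_prob n q (P x))"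
  using assms(2)
proof induction
  case empty
  then show ?case by (simp add: mallows_prob_def)
next
  case (insert x F)
  have "mallows_prob n q (\<lambda>\<pi>. \<exists>x\<in>insert x F. P x \<pi>)
      \<le> mallows_prob n q (P x) + mallows_prob n q (\<lambda>\<pi>. \<exists>x\<in>F. P x \<pi>)"
    using mallows_prob_disj_le[OF assms(1), of n "P x" "\<lambda>\<pi>. \<exists>x\<in>F. P x \<pi>"] by simp
  with insert show ?case by simp
qed

section \<open>The law of the Lehmer code\<close>

lemma sum_lehmer:
  fixes q :: real
  shows "(\<Sum>\<pi>\<in>{\<pi>\<in>perms n. Q (lehmer n \<pi>)}. q ^ inversions n \<pi>)
    = (\<Sum>c\<in>{c\<in>codes n. Q c}. \<Prod>i\<in>{1..n}. q ^ c i)"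
proof -
  have "bij_betw (lehmer n) {\<pi>\<in>perms n. Q (lehmer n \<pi>)} {c\<in>codes n. Q c}"
    using bij_betw_lehmer[of n] by (auto simp: bij_betw_def inj_on_def)
  from sum.reindex_bij_betw[OF this, of "\<lambda>c. \<Prod>i\<in>{1..n}. q ^ c i"]
  show ?thesis by (simp add: inversions_eq_sum_lehmer power_sum)
qed

text \<open>Since the weights factor over the code, the partition function is the
  q-factorial.\<close>

lemma mallows_Z_eq_prod: "mallows_Z n q = (\<Prod>i\<in>{1..n}. \<Sum>c\<in>{..n - i}. q ^ c)"
  using sum_lehmer[where n=n and q=q and Q="\<lambda>_. True"]
  by (simp add: mallows_Z_def codes_def prod_sum_PiE)

lemma mallows_prob_lehmer:
  "mallows_prob n q (\<lambda>\<pi>. Q (lehmer n \<pi>)) =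
    (\<Sum>c\<in>{c\<in>codes n. Q c}. \<Prod>i\<in>{1..n}. q ^ c i) / (\<Prod>i\<in>{1..n}. \<Sum>c\<in>{..n - i}. q ^ c)"
  unfolding mallows_prob_def sum_lehmer mallows_Z_eq_prod ..

text \<open>Shifting by \<open>a\<close> maps the tail into the full range. Divided by the full sum,
  this bounds the tail of the truncated geometric law by \<open>q ^ a\<close>.\<close>

lemma sum_power_tail_le:
  fixes q :: real
  assumes "0 < q"
  shows "(\<Sum>c\<in>{a..N}. q ^ c) \<le> q ^ a * (\<Sum>c\<in>{..N}. q ^ c)"
proof -
  have "(\<Sum>c\<in>{a..N}. q ^ c) = (\<Sum>c\<in>{a..N}. q ^ a * q ^ (c - a))"
    by (intro sum.cong) (auto simp flip: power_add)
  also have "\<dots> = (\<Sum>c\<in>(\<lambda>c. c - a) ` {a..N}. q ^ a * q ^ c)"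
    by (subst sum.reindex) (auto simp: inj_on_def)
  also have "\<dots> \<le> (\<Sum>c\<in>{..N}. q ^ a * q ^ c)"
    using assms by (intro sum_mono2) auto
  finally show ?thesis by (simp add: sum_distrib_left)
qed

text \<open>The condition cuts a sub-box out of \<open>codes n\<close>, so the probability is a
  product of one-coordinate tails, each at most \<open>q ^ a i\<close>. Both terms of
  \<open>mallows_prob_longest_ge_le\<close> come from this estimate.\<close>

lemma mallows_prob_lehmer_ge:
  fixes q :: real
  assumes "0 < q"
  shows "mallows_prob n q (\<lambda>\<pi>. \<forall>i\<in>{1..n}. a i \<le> lehmer n \<pi> i) \<le> q ^ (\<Sum>i\<in>{1..n}. a i)"
proof -
  have T: "(\<Sum>c\<in>{..n - i}. q ^ c) > 0" for i using assms by (intro sum_pos) auto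
  have "{c \<in> codes n. \<forall>i\<in>{1..n}. a i \<le> c i} = (\<Pi>\<^sub>E i\<in>{1..n}. {a i..n - i})"
    unfolding codes_def set_eq_iff mem_Collect_eq PiE_iff atLeastAtMost_iff atMost_iff by blast
  then have "(\<Sum>c\<in>{c \<in> codes n. \<forall>i\<in>{1..n}. a i \<le> c i}. \<Prod>i\<in>{1..n}. q ^ c i)
      = (\<Prod>i\<in>{1..n}. \<Sum>c\<in>{a i..n - i}. q ^ c)"
    by (simp add: prod_sum_PiE)
  also have "\<dots> \<le> (\<Prod>i\<in>{1..n}. q ^ a i * (\<Sum>c\<in>{..n - i}. q ^ c))"
    using assms by (intro prod_mono conjI sum_power_tail_le sum_nonneg) auto
  also have "\<dots> = q ^ (\<Sum>i\<in>{1..n}. a i) * (\<Prod>i\<in>{1..n}. \<Sum>c\<in>{..n - i}. q ^ c)"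
    by (simp add: prod.distrib power_sum)
  finally show ?thesis
    unfolding mallows_prob_lehmer[where Q="\<lambda>c. \<forall>i\<in>{1..n}. a i \<le> c i"]
    using T by (simp add: divide_le_eq prod_pos)
qed

lemma mallows_prob_lehmer_large_le:
  fixes q :: real
  assumes "0 < q"
  shows "mallows_prob n q (\<lambda>\<pi>. \<exists>i\<in>{1..n}. D \<le> lehmer n \<pi> i) \<le> n * q ^ D"
proof -
  have "mallows_prob n q (\<lambda>\<pi>. D \<le> lehmer n \<pi> i) \<le> q ^ D" if i: "i \<in> {1..n}" for i
  proof -
    have "mallows_prob n q (\<lambda>\<pi>. D \<le> lehmer n \<pi> i)
        = mallows_prob n q (\<lambda>\<pi>. \<forall>j\<in>{1..n}. (if j = i then D else 0) \<le> lehmer n \<pi> j)"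
      using i by (intro mallows_prob_cong) auto
    also have "\<dots> \<le> q ^ (\<Sum>j\<in>{1..n}. if j = i then D else 0)"
      using assms by (rule mallows_prob_lehmer_ge)
    also have "(\<Sum>j\<in>{1..n}. if j = i then D else 0) = D" using i by simp
    finally show ?thesis .
  qed
  then have "(\<Sum>i\<in>{1..n}. mallows_prob n q (\<lambda>\<pi>. D \<le> lehmer n \<pi> i)) \<le> (\<Sum>i\<in>{1..n}. q ^ D)"
    by (intro sum_mono) auto
  moreover note mallows_prob_bex_le[OF assms, of "{1..n}" n "\<lambda>i \<pi>. D \<le> lehmer n \<pi> i"]
  ultimately show ?thesis by simp
qed

section \<open>Symmetry under inverses and the range of inversions\<close>

lemma inversions_inv:
  assumes "\<pi> permutes {1..n}"
  shows "inversions n (inv \<pi>) = inversions n \<pi>"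
proof -
  have inv: "inv \<pi> permutes {1..n}" using assms by (rule permutes_inv)
  \<comment> \<open>A pair inverted by \<open>inv \<pi>\<close> is a pair of values of
    \<open>\<pi>\<close>; the positions of these values, in exchanged order, are inverted by
    \<open>\<pi>\<close>.\<close>
  have "bij_betw (\<lambda>(i, j). (inv \<pi> j, inv \<pi> i))
    {(i, j). 1 \<le> i \<and> i < j \<and> j \<le> n \<and> inv \<pi> i > inv \<pi> j}
    {(i, j). 1 \<le> i \<and> i < j \<and> j \<le> n \<and> \<pi> i > \<pi> j}"
    using permutes_mem[OF assms] permutes_mem[OF inv] permutes_inverses[OF assms]
    by (intro bij_betw_byWitness[where f'="\<lambda>(i, j). (\<pi> j, \<pi> i)"]) force+
  then show ?thesis unfolding inversions_def by (rule bij_betw_same_card)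
qed

text \<open>Bounds on the code of \<open>\<pi>\<close> thus carry over to the code of
  \<open>inv \<pi>\<close> with the same probability.\<close>

lemma mallows_prob_inv: "mallows_prob n q (\<lambda>\<pi>. P (inv \<pi>)) = mallows_prob n q P"
proof -
  have "bij_betw inv {\<pi>\<in>perms n. P (inv \<pi>)} {\<pi>\<in>perms n. P \<pi>}"
    by (intro bij_betw_byWitness[where f'=inv])
       (auto simp: perms_def permutes_inv permutes_inv_inv)
  from sum.reindex_bij_betw[OF this, of "\<lambda>\<pi>. q ^ inversions n \<pi>"]
  have "(\<Sum>\<pi>\<in>{\<pi>\<in>perms n. P \<pi>}. q ^ inversions n \<pi>)
      = (\<Sum>\<pi>\<in>{\<pi>\<in>perms n. P (inv \<pi>)}. q ^ inversions n (inv \<pi>))" ..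
  also have "\<dots> = (\<Sum>\<pi>\<in>{\<pi>\<in>perms n. P (inv \<pi>)}. q ^ inversions n \<pi>)"
    by (intro sum.cong) (auto simp: perms_def inversions_inv)
  finally show ?thesis by (simp add: mallows_prob_def)
qed

text \<open>Among the \<open>\<pi> i - 1\<close> smaller values at most \<open>i - 1\<close> are
  used by earlier positions; the code counts the rest.\<close>

lemma permutation_le_lehmer:
  assumes "\<pi> permutes {1..n}" "i \<in> {1..n}"
  shows "\<pi> i \<le> i + lehmer n \<pi> i"
proof -
  have "i \<ge> 1" "\<pi> i \<ge> 1" using assms permutes_mem[OF assms] by auto
  have "\<pi> i - 1 - (i - 1) \<le> card {1..<\<pi> i} - card (\<pi> ` {1..<i})"
    using card_image_le[of "{1..<i}" \<pi>] by simp
  also have "\<dots> \<le> lehmer n \<pi> i"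
    unfolding lehmer_eq_card_values[OF assms] by (intro diff_card_le_card_Diff) auto
  finally show ?thesis using \<open>i \<ge> 1\<close> \<open>\<pi> i \<ge> 1\<close> by linarith
qed

text \<open>Chains \<open>j < \<pi> j + D\<close>, \<open>\<pi> j < \<pi> i\<close> and
  \<open>\<pi> i < i + D\<close>; the first is the displacement bound for \<open>inv \<pi>\<close>
  at the value \<open>\<pi> j\<close>.\<close>

lemma inversion_gap_less:
  assumes \<pi>: "\<pi> permutes {1..n}" and ij: "i \<in> {1..n}" "j \<in> {1..n}" "\<pi> j < \<pi> i"
    and D: "\<forall>i\<in>{1..n}. lehmer n \<pi> i < D" "\<forall>i\<in>{1..n}. lehmer n (inv \<pi>) i < D"
  shows "j < i + 2 * D"
proof -
  have j: "\<pi> j \<in> {1..n}" using permutes_mem[OF \<pi> ij(2)] .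
  have "\<pi> i \<le> i + lehmer n \<pi> i" using \<pi> ij(1) by (rule permutation_le_lehmer)
  moreover have "inv \<pi> (\<pi> j) \<le> \<pi> j + lehmer n (inv \<pi>) (\<pi> j)"
    using permutes_inv[OF \<pi>] j by (rule permutation_le_lehmer)
  ultimately show ?thesis
    using D(1)[rule_format, OF ij(1)] D(2)[rule_format, OF j] ij(3) permutes_inverses[OF \<pi>] by simp
qed

text \<open>Listed from the largest element down, the summands are 0, 1, 2 and so on. Adding a new
  maximum raises each old summand by one and contributes 0 itself.\<close>

lemma sum_card_greater:
  fixes S :: "'a :: linorder set"
  assumes "finite S"
  shows "(\<Sum>i\<in>S. card {j\<in>S. i < j}) = card S choose 2"
  using assms
proof (induction rule: finite_linorder_max_induct)
  case (insert b S)
  have "card {j\<in>insert b S. i < j} = Suc (card {j\<in>S. i < j})" if "i \<in> S" for i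
  proof -
    have "{j\<in>insert b S. i < j} = insert b {j\<in>S. i < j}" using that insert by auto
    moreover have "b \<notin> S" using insert by auto
    ultimately show ?thesis using insert by simp
  qed
  then have "(\<Sum>i\<in>S. card {j\<in>insert b S. i < j}) = (\<Sum>i\<in>S. Suc (card {j\<in>S. i < j}))"
    by (intro sum.cong refl)
  also have "\<dots> = card S + (card S choose 2)"
    using insert.IH by (simp only: sum_Suc add.commute)
  finally have "(\<Sum>i\<in>S. card {j\<in>insert b S. i < j}) = card S + (card S choose 2)" .
  moreover have "{j\<in>insert b S. b < j} = {}" using insert by auto
  moreover have "b \<notin> S" using insert by auto
  ultimately have "(\<Sum>i\<in>insert b S. card {j\<in>insert b S. i < j}) = card S + (card S choose 2)"
    using sum.insert[OF insert.hyps(1) \<open>b \<notin> S\<close>, of "\<lambda>i. card {j\<in>insert b S. i < j}"]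
    by (simp only: card.empty add_0)
  also have "\<dots> = Suc (card S) choose 2" by (simp add: numeral_2_eq_2)
  finally show ?case using insert \<open>b \<notin> S\<close> by simp
qed (simp add: numeral_2_eq_2)

section \<open>Long decreasing subsequences are unlikely\<close>

text \<open>Sets replace lists of positions because the union bound runs over subsets of a
  window.\<close>

definition decreasing_on :: "(nat \<Rightarrow> nat) \<Rightarrow> nat set \<Rightarrow> bool" where
  "decreasing_on \<pi> S \<longleftrightarrow> (\<forall>i\<in>S. \<forall>j\<in>S. i < j \<longrightarrow> \<pi> j < \<pi> i)"

lemma decreasing_on_lehmer_ge:
  assumes "decreasing_on \<pi> S" "S \<subseteq> {1..n}" "i \<in> S"
  shows "card {j\<in>S. i < j} \<le> lehmer n \<pi> i"
proof -
  have "card {j\<in>S. i < j} \<le> card {j\<in>{1..n}. i < j \<and> \<pi> j < \<pi> i}"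
    using assms by (intro card_mono) (auto simp: decreasing_on_def)
  then show ?thesis using assms by (auto simp: lehmer_def)
qed

text \<open>On \<open>S\<close> the code must be at least the number of later elements of
  \<open>S\<close>; these thresholds add up to \<open>card S choose 2\<close>, and threshold 0
  elsewhere costs nothing.\<close>

lemma mallows_prob_decreasing_on_le:
  fixes q :: real
  assumes "0 < q" "S \<subseteq> {1..n}"
  shows "mallows_prob n q (\<lambda>\<pi>. decreasing_on \<pi> S) \<le> q ^ (card S choose 2)"
proof -
  let ?a = "\<lambda>i. if i \<in> S then card {j\<in>S. i < j} else 0"
  have fin: "finite S" using assms(2) finite_subset by blast
  have "mallows_prob n q (\<lambda>\<pi>. decreasing_on \<pi> S)
      \<le> mallows_prob n q (\<lambda>\<pi>. \<forall>i\<in>{1..n}. ?a i \<le> lehmer n \<pi> i)"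
    using assms decreasing_on_lehmer_ge by (intro mallows_prob_mono) auto
  also have "\<dots> \<le> q ^ (\<Sum>i\<in>{1..n}. ?a i)"
    using assms(1) by (rule mallows_prob_lehmer_ge)
  also have "(\<Sum>i\<in>{1..n}. ?a i) = (\<Sum>i\<in>S. card {j\<in>S. i < j})"
    using assms(2) by (intro sum.mono_neutral_cong_right) auto
  finally show ?thesis by (simp add: sum_card_greater[OF fin])
qed

lemma longest_decreasing_ge_iff:
  "k \<le> longest_decreasing n \<pi> \<longleftrightarrow> (\<exists>S\<subseteq>{1..n}. card S = k \<and> decreasing_on \<pi> S)"
proof
  assume k: "k \<le> longest_decreasing n \<pi>"
  have "longest_decreasing n \<pi> \<in> {length is |is. decreasing_subseq n \<pi> is}"
    unfolding longest_decreasing_def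
    by (rule Max_in[OF finite_decreasing_subseq_lengths decreasing_subseq_lengths_nonempty])
  then obtain "is" where is': "decreasing_subseq n \<pi> is" "k \<le> length is"
    using k by auto
  \<comment> \<open>A prefix of a longest subsequence has length exactly \<open>k\<close>.\<close>
  define js where "js = take k is"
  have js: "set js \<subseteq> {1..n}" "sorted_wrt (<) js" "sorted_wrt (>) (map \<pi> js)" "length js = k"
    using is' set_take_subset[of k "is"]
    by (auto simp: js_def decreasing_subseq_def sorted_wrt_take simp flip: take_map)
  have "decreasing_on \<pi> (set js)"
    unfolding decreasing_on_def
  proof (intro ballI impI)
    fix i j assume "i \<in> set js" "j \<in> set js" "i < j"
    then obtain a b where ab: "a < length js" "i = js ! a" "b < length js" "j = js ! b"
      by (metis in_set_conv_nth)
    then have "a < b"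
      using js(2) \<open>i < j\<close> by (metis linorder_less_linear not_less_iff_gr_or_eq sorted_wrt_iff_nth_less)
    then show "\<pi> j < \<pi> i"
      using js(3) ab by (auto simp: sorted_wrt_iff_nth_less)
  qed
  moreover have "card (set js) = k"
    using js by (simp add: strict_sorted_iff distinct_card)
  ultimately show "\<exists>S\<subseteq>{1..n}. card S = k \<and> decreasing_on \<pi> S" using js(1) by blast
next
  assume "\<exists>S\<subseteq>{1..n}. card S = k \<and> decreasing_on \<pi> S"
  then obtain S where S: "S \<subseteq> {1..n}" "card S = k" "decreasing_on \<pi> S" by blast
  then have fin: "finite S" using finite_subset by blast
  define js where "js = sorted_list_of_set S"
  have js: "sorted_wrt (<) js" "set js = S" "length js = k"
    using fin S by (auto simp: js_def)
  have "sorted_wrt (>) (map \<pi> js)"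
    unfolding sorted_wrt_map using js(1)
    by (rule sorted_wrt_mono_rel[rotated]) (use S(3) js(2) in \<open>auto simp: decreasing_on_def\<close>)
  then have "decreasing_subseq n \<pi> js"
    using js S by (auto simp: decreasing_subseq_def)
  then show "k \<le> longest_decreasing n \<pi>"
    unfolding longest_decreasing_def
    using js by (intro Max_ge finite_decreasing_subseq_lengths) auto
qed

text \<open>Unless the code of \<open>\<pi>\<close> or of \<open>inv \<pi>\<close> reaches
  \<open>D\<close>, a decreasing set of size \<open>k\<close> fits in the window of length
  \<open>2 * D\<close> starting at its minimum. The first term pays for the two codes, the second
  for all windows and their \<open>k\<close>-subsets.\<close>

lemma mallows_prob_longest_ge_le:
  fixes q :: real
  assumes "0 < q" "1 \<le> k"
  shows "mallows_prob n q (\<lambda>\<pi>. k \<le> longest_decreasing n \<pi>)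
    \<le> 2 * real n * q ^ D + real n * real (2 * D choose k) * q ^ (k choose 2)"
proof -
  let ?P1 = "\<lambda>\<pi>. \<exists>i\<in>{1..n}. D \<le> lehmer n \<pi> i"
  let ?P2 = "\<lambda>\<pi>. \<exists>i\<in>{1..n}. D \<le> lehmer n (inv \<pi>) i"
  \<comment> \<open>Windows may run past \<open>n\<close>. The condition that the set stays inside
    \<open>{1..n}\<close> is put into the event \<open>?P3\<close>, which keeps the count
    exact.\<close>
  define F where "F = (SIGMA i:{1..n}. {S. S \<subseteq> {i..<i + 2 * D} \<and> card S = k})"
  let ?P3 = "\<lambda>\<pi>. \<exists>x\<in>F. snd x \<subseteq> {1..n} \<and> decreasing_on \<pi> (snd x)"
  have "finite {S. S \<subseteq> {i..<i + 2 * D} \<and> card S = k}" for i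
    by (rule finite_subset[of _ "Pow {i..<i + 2 * D}"]) auto
  then have finF: "finite F" by (auto simp: F_def)
  have cardF: "card F = n * (2 * D choose k)"
    by (simp add: F_def n_subsets)
  have cover: "?P1 \<pi> \<or> ?P2 \<pi> \<or> ?P3 \<pi>"
    if \<pi>: "\<pi> \<in> perms n" and k: "k \<le> longest_decreasing n \<pi>" for \<pi>
  proof (rule ccontr)
    assume neg: "\<not> (?P1 \<pi> \<or> ?P2 \<pi> \<or> ?P3 \<pi>)"
    then have D: "\<forall>i\<in>{1..n}. lehmer n \<pi> i < D" "\<forall>i\<in>{1..n}. lehmer n (inv \<pi>) i < D"
      by (auto simp: not_le)
    have perm: "\<pi> permutes {1..n}" using \<pi> by (simp add: perms_def)
    obtain S where S: "S \<subseteq> {1..n}" "card S = k" "decreasing_on \<pi> S"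
      using k unfolding longest_decreasing_ge_iff by blast
    have fin: "finite S" "S \<noteq> {}" using S \<open>1 \<le> k\<close> by (auto intro: finite_subset)
    define i where "i = Min S"
    have i: "i \<in> S" "\<And>j. j \<in> S \<Longrightarrow> i \<le> j" using fin by (auto simp: i_def)
    have "j < i + 2 * D" if "j \<in> S" for j
    proof (cases "j = i")
      case True
      \<comment> \<open>The strict bound on the code at \<open>i\<close> forces
        \<open>D > 0\<close>.\<close>
      then show ?thesis using D(1) i(1) S(1) by fastforce
    next
      case False
      then have "\<pi> j < \<pi> i"
        using i that S(3) by (auto simp: decreasing_on_def order.strict_iff_order)
      then show ?thesis
        using inversion_gap_less[OF perm _ _ _ D] i(1) that S(1) by blast
    qed
    then have "S \<subseteq> {i..<i + 2 * D}" using i(2) by auto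
    then have "(i, S) \<in> F" using i(1) S by (auto simp: F_def)
    then show False using neg S by force
  qed
  have "mallows_prob n q (\<lambda>\<pi>. k \<le> longest_decreasing n \<pi>)
      \<le> mallows_prob n q (\<lambda>\<pi>. ?P1 \<pi> \<or> ?P2 \<pi> \<or> ?P3 \<pi>)"
    using assms(1) cover by (intro mallows_prob_mono) auto
  also have "\<dots> \<le> mallows_prob n q ?P1 + mallows_prob n q (\<lambda>\<pi>. ?P2 \<pi> \<or> ?P3 \<pi>)"
    using assms(1) by (rule mallows_prob_disj_le)
  also have "mallows_prob n q (\<lambda>\<pi>. ?P2 \<pi> \<or> ?P3 \<pi>) \<le> mallows_prob n q ?P2 + mallows_prob n q ?P3"
    using assms(1) by (rule mallows_prob_disj_le)
  also have "mallows_prob n q ?P2 = mallows_prob n q ?P1"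
    by (rule mallows_prob_inv[where P="?P1"])
  also have "mallows_prob n q ?P1 \<le> n * q ^ D"
    using assms(1) by (rule mallows_prob_lehmer_large_le)
  also have "mallows_prob n q ?P3 \<le> real n * real (2 * D choose k) * q ^ (k choose 2)"
  proof -
    have le: "mallows_prob n q (\<lambda>\<pi>. S \<subseteq> {1..n} \<and> decreasing_on \<pi> S) \<le> q ^ (k choose 2)"
      if "card S = k" for S
    proof (cases "S \<subseteq> {1..n}")
      case True
      then show ?thesis using mallows_prob_decreasing_on_le[OF assms(1) True] that by simp
    next
      case False
      then show ?thesis using assms(1) by (simp add: mallows_prob_def)
    qed
    have "mallows_prob n q ?P3
        \<le> (\<Sum>x\<in>F. mallows_prob n q (\<lambda>\<pi>. snd x \<subseteq> {1..n} \<and> decreasing_on \<pi> (snd x)))"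
      using assms(1) finF by (rule mallows_prob_bex_le)
    also have "\<dots> \<le> (\<Sum>x\<in>F. q ^ (k choose 2))"
      by (intro sum_mono le) (auto simp: F_def)
    finally show ?thesis by (simp add: cardF)
  qed
  finally show ?thesis by simp
qed

section \<open>Moderately long decreasing subsequences are likely\<close>

text \<open>In the induction step, forcing the pattern \<open>t\<close> on the new block amounts to shrinking \<open>A i\<close> to
  \<open>{t i}\<close> there, so the induction hypothesis is needed both for \<open>A\<close> and for the shrunk family.\<close>

lemma sum_PiE_avoiding_blocks:
  fixes w :: "'i \<Rightarrow> 'a \<Rightarrow> 'b :: comm_ring_1"
  assumes "finite J" "finite I" "\<And>i. i \<in> I \<Longrightarrow> finite (A i)" "\<And>j. j \<in> J \<Longrightarrow> B j \<subseteq> I"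
    and "disjoint_family_on B J" "\<And>j i. j \<in> J \<Longrightarrow> i \<in> B j \<Longrightarrow> t i \<in> A i"
  shows "(\<Sum>c\<in>{c\<in>PiE I A. \<forall>j\<in>J. \<exists>i\<in>B j. c i \<noteq> t i}. \<Prod>i\<in>I. w i (c i))
    = (\<Prod>i\<in>I - \<Union>(B ` J). \<Sum>a\<in>A i. w i a)
      * (\<Prod>j\<in>J. (\<Prod>i\<in>B j. \<Sum>a\<in>A i. w i a) - (\<Prod>i\<in>B j. w i (t i)))"
  using assms
proof (induction J arbitrary: A)
  case empty
  then show ?case by (simp add: prod_sum_PiE)
next
  case (insert b J A)
  let ?Q = "\<lambda>c. \<forall>j\<in>J. \<exists>i\<in>B j. c i \<noteq> t i"
  let ?W = "\<lambda>c. \<Prod>i\<in>I. w i (c i)"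
  let ?K = "I - \<Union>(B ` J)"
  define A' where "A' = (\<lambda>i. if i \<in> B b then {t i} else A i)"
  define T where "T = (\<lambda>i. \<Sum>a\<in>A i. w i a)"
  define P where "P = (\<Prod>j\<in>J. (\<Prod>i\<in>B j. T i) - (\<Prod>i\<in>B j. w i (t i)))"
  have B: "B b \<subseteq> I" using insert.prems(3) by simp
  have disj: "i \<notin> B b" if "j \<in> J" "i \<in> B j" for i j
    using insert.prems(4) insert.hyps(2) that
    by (fastforce simp: disjoint_family_on_def)
  have disjJ: "disjoint_family_on B J"
    using insert.prems(4) by (auto simp: disjoint_family_on_def)
  have t: "t i \<in> A i" if "j \<in> J" "i \<in> B j" for i j
    using insert.prems(5)[of j i] that by simp
  have fin: "finite (PiE I A)" using insert.prems by (intro finite_PiE) auto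
  have IH1: "(\<Sum>c\<in>{c\<in>PiE I A. ?Q c}. ?W c) = (\<Prod>i\<in>?K. T i) * P"
    unfolding T_def P_def
    by (rule insert.IH) (use insert.prems(1-3) disjJ t in simp_all)
  have "(\<Sum>c\<in>{c\<in>PiE I A'. ?Q c}. ?W c) = (\<Prod>i\<in>?K. \<Sum>a\<in>A' i. w i a)
      * (\<Prod>j\<in>J. (\<Prod>i\<in>B j. \<Sum>a\<in>A' i. w i a) - (\<Prod>i\<in>B j. w i (t i)))"
    by (rule insert.IH) (use insert.prems(1-3) disjJ t disj in \<open>simp_all add: A'_def\<close>)
  also have "(\<Prod>j\<in>J. (\<Prod>i\<in>B j. \<Sum>a\<in>A' i. w i a) - (\<Prod>i\<in>B j. w i (t i))) = P"
    unfolding P_def T_def using disj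
    by (intro prod.cong arg_cong2[where f="(-)"]) (auto simp: A'_def)
  finally have IH2: "(\<Sum>c\<in>{c\<in>PiE I A'. ?Q c}. ?W c) = (\<Prod>i\<in>?K. \<Sum>a\<in>A' i. w i a) * P" .
  have sub: "B b \<subseteq> ?K" using B disj by blast
  have finK: "finite ?K" using insert.prems(1) by simp
  have K: "?K - B b = I - \<Union>(B ` insert b J)" by auto
  have R1: "(\<Prod>i\<in>?K. T i) = (\<Prod>i\<in>I - \<Union>(B ` insert b J). T i) * (\<Prod>i\<in>B b. T i)"
    using prod.subset_diff[OF sub finK, of T] unfolding K .
  have "(\<Prod>i\<in>?K. \<Sum>a\<in>A' i. w i a)
      = (\<Prod>i\<in>I - \<Union>(B ` insert b J). \<Sum>a\<in>A' i. w i a) * (\<Prod>i\<in>B b. \<Sum>a\<in>A' i. w i a)"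
    using prod.subset_diff[OF sub finK, of "\<lambda>i. \<Sum>a\<in>A' i. w i a"] unfolding K .
  also have "(\<Prod>i\<in>B b. \<Sum>a\<in>A' i. w i a) = (\<Prod>i\<in>B b. w i (t i))"
    by (intro prod.cong) (auto simp: A'_def)
  also have "(\<Prod>i\<in>I - \<Union>(B ` insert b J). \<Sum>a\<in>A' i. w i a) = (\<Prod>i\<in>I - \<Union>(B ` insert b J). T i)"
    by (intro prod.cong) (auto simp: A'_def T_def)
  finally have R2: "(\<Prod>i\<in>?K. \<Sum>a\<in>A' i. w i a)
      = (\<Prod>i\<in>I - \<Union>(B ` insert b J). T i) * (\<Prod>i\<in>B b. w i (t i))" .
  have mem: "c \<in> PiE I A' \<longleftrightarrow> c \<in> PiE I A \<and> (\<forall>i\<in>B b. c i = t i)" for c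
    using B insert.prems(5) by (simp add: PiE_iff A'_def) (metis insertI1 singletonD subsetD)
  \<comment> \<open>Avoiding the pattern on the new block as well removes, from the families that
    avoid it on all blocks of \<open>J\<close>, those that carry it on \<open>B b\<close>.\<close>
  have "{c\<in>PiE I A. \<forall>j\<in>insert b J. \<exists>i\<in>B j. c i \<noteq> t i}
      = {c\<in>PiE I A. ?Q c} - {c\<in>PiE I A'. ?Q c}"
    unfolding mem by blast
  then have "(\<Sum>c\<in>{c\<in>PiE I A. \<forall>j\<in>insert b J. \<exists>i\<in>B j. c i \<noteq> t i}. ?W c)
      = (\<Sum>c\<in>{c\<in>PiE I A. ?Q c}. ?W c) - (\<Sum>c\<in>{c\<in>PiE I A'. ?Q c}. ?W c)"
    using fin mem by (simp only:) (rule sum_diff, auto)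
  also have "\<dots> = (\<Prod>i\<in>I - \<Union>(B ` insert b J). T i)
      * (((\<Prod>i\<in>B b. T i) - (\<Prod>i\<in>B b. w i (t i))) * P)"
    unfolding IH1 IH2 R1 R2 by (simp add: algebra_simps)
  finally show ?case
    using insert.hyps by (simp add: T_def P_def)
qed

text \<open>If the value does not drop, every position counted at \<open>i\<close> is also counted
  at \<open>i + 1\<close>.\<close>

lemma descent_of_lehmer_less:
  assumes "1 \<le> i" "Suc i \<le> n" "lehmer n \<pi> (Suc i) < lehmer n \<pi> i"
  shows "\<pi> (Suc i) < \<pi> i"
proof (rule ccontr)
  assume "\<not> \<pi> (Suc i) < \<pi> i"
  then have "{j\<in>{1..n}. i < j \<and> \<pi> j < \<pi> i} \<subseteq> {j\<in>{1..n}. Suc i < j \<and> \<pi> j < \<pi> (Suc i)}"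
    by (auto simp: order.strict_iff_order Suc_le_eq[symmetric])
  then have "lehmer n \<pi> i \<le> lehmer n \<pi> (Suc i)"
    using assms(1,2) by (auto simp: lehmer_def intro!: card_mono)
  then show False using assms(3) by simp
qed

text \<open>The code drops by one at each step of the block, so neighbouring values descend and the
  descents chain up.\<close>

lemma decreasing_on_block:
  assumes "a + k \<le> n" "\<And>l. l < k \<Longrightarrow> lehmer n \<pi> (Suc (a + l)) = k - 1 - l"
  shows "decreasing_on \<pi> {Suc a..a + k}"
proof -
  have less: "\<pi> j < \<pi> i" if "Suc a \<le> i" "i < j" "j \<le> a + k" for i j
    using that(2,3)
  proof (induction j)
    case (Suc j)
    have "Suc a \<le> j" "Suc j \<le> a + k" using Suc.prems that(1) by linarith+
    then have "lehmer n \<pi> (Suc j) < lehmer n \<pi> j"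
      using assms(2)[of "j - a"] assms(2)[of "j - Suc a"] by (simp add: Suc_diff_le)
    then have "\<pi> (Suc j) < \<pi> j"
      using \<open>Suc a \<le> j\<close> \<open>Suc j \<le> a + k\<close> assms(1) by (intro descent_of_lehmer_less) auto
    moreover have "j = i \<or> \<pi> j < \<pi> i" using Suc by linarith
    ultimately show ?case by auto
  qed simp
  then show ?thesis by (auto simp: decreasing_on_def)
qed

lemma sum_lessThan_choose_two: "(\<Sum>l<k. l) = k choose 2"
  by (induction k) (simp_all add: numeral_2_eq_2)

text \<open>Without a decreasing subsequence of length \<open>k\<close>, none of
  \<open>n div k\<close> disjoint blocks carries the pattern of \<open>decreasing_on_block\<close>.
  The blocks are independent, and each avoids the pattern with probability at most
  \<open>1 - p\<close>, with \<open>p\<close> as defined in the proof.\<close>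

lemma mallows_prob_longest_less_le:
  fixes q :: real
  assumes "0 < q" "q < 1" "1 \<le> k"
  shows "mallows_prob n q (\<lambda>\<pi>. longest_decreasing n \<pi> < k)
    \<le> (1 - (1 - q) ^ k * q ^ (k choose 2)) ^ (n div k)"
proof -
  \<comment> \<open>Block \<open>j\<close> starts at \<open>j * k + 1\<close>, as positions count
    from 1; \<open>t\<close> repeats the pattern \<open>k - 1, ..., 0\<close> on every
    block.\<close>
  define B where "B = (\<lambda>j. {Suc (j * k)..j * k + k})"
  define J where "J = {..<n div k}"
  define t where "t = (\<lambda>i. k - 1 - (i - 1) mod k)"
  define T where "T = (\<lambda>i. \<Sum>c\<in>{..n - i}. q ^ c)"
  define p where "p = (1 - q) ^ k * q ^ (k choose 2)"
  have Bimage: "B j = (\<lambda>l. Suc (j * k + l)) ` {..<k}" for j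
  proof -
    have "i \<in> (\<lambda>l. Suc (j * k + l)) ` {..<k}" if "i \<in> B j" for i
      using that by (intro image_eqI[of _ _ "i - Suc (j * k)"]) (auto simp: B_def)
    then show ?thesis by (auto simp: B_def)
  qed
  have t: "t (Suc (j * k + l)) = k - 1 - l" if "l < k" for j l
    using that by (simp add: t_def)
  have Bn: "j * k + k \<le> n" if "j \<in> J" for j
  proof -
    have "Suc j * k \<le> (n div k) * k" using that by (intro mult_right_mono) (auto simp: J_def)
    also have "\<dots> \<le> n" by simp
    finally show ?thesis by simp
  qed
  have disj: "disjoint_family_on B J"
    unfolding disjoint_family_on_def
  proof (intro ballI impI)
    have div: "(i - 1) div k = j" if "i \<in> B j" for i j
      using that assms(3) unfolding Bimage by (auto simp: div_mult_self3)
    fix j j' :: nat assume "j \<noteq> j'"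
    then show "B j \<inter> B j' = {}" using div by blast
  qed
  \<comment> \<open>The pattern is an admissible code: the positions left in the block are at most
    those left up to \<open>n\<close>.\<close>
  have tA: "t i \<le> n - i" if "j \<in> J" "i \<in> B j" for i j
    using that(2) Bn[OF that(1)] t unfolding Bimage by auto
  have Bsub: "B j \<subseteq> {1..n}" if "j \<in> J" for j
    using Bn[OF that] by (auto simp: B_def)
  have T_pos: "T i > 0" for i using assms(1) by (auto simp: T_def intro!: sum_pos)
  \<comment> \<open>The partial geometric sum is at most \<open>1 / (1 - q)\<close>, so each
    prescribed code value has probability at least \<open>(1 - q) * q ^ t i\<close>.\<close>
  have T_le: "(1 - q) * T i \<le> 1" for i
    unfolding T_def atLeast0AtMost[symmetric] using assms(1) by (simp add: one_diff_power_eq' sum_gp_multiplied)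
  have sum_t: "(\<Sum>i\<in>B j. t i) = k choose 2" for j
  proof -
    have "(\<Sum>i\<in>B j. t i) = (\<Sum>l<k. k - 1 - l)"
      unfolding Bimage by (subst sum.reindex) (auto simp: inj_on_def t)
    also have "\<dots> = (\<Sum>l<k. l)"
      using sum.nat_diff_reindex[of "\<lambda>l. l" k] by simp
    finally show ?thesis by (simp add: sum_lessThan_choose_two)
  qed
  have cardB: "card (B j) = k" for j by (simp add: B_def)
  have block: "(\<Prod>i\<in>B j. T i) - (\<Prod>i\<in>B j. q ^ t i) \<le> (1 - p) * (\<Prod>i\<in>B j. T i)" for j
  proof -
    have "(\<Prod>i\<in>B j. (1 - q) * T i) \<le> 1"
      using T_pos assms T_le by (intro prod_le_1) (auto intro: less_imp_le)
    then have "(1 - q) ^ k * (\<Prod>i\<in>B j. T i) \<le> 1"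
      by (simp add: prod.distrib cardB)
    then have "q ^ (k choose 2) * ((1 - q) ^ k * (\<Prod>i\<in>B j. T i)) \<le> q ^ (k choose 2) * 1"
      using assms(1) by (intro mult_left_mono) auto
    then show ?thesis by (simp add: p_def sum_t algebra_simps flip: power_sum)
  qed
  have block_nonneg: "0 \<le> (\<Prod>i\<in>B j. T i) - (\<Prod>i\<in>B j. q ^ t i)" if "j \<in> J" for j
  proof -
    have "q ^ t i \<le> T i" if "i \<in> B j" for i
      unfolding T_def using assms(1) tA[OF \<open>j \<in> J\<close> that] by (intro member_le_sum) auto
    then show ?thesis using assms(1) by (auto intro!: prod_mono)
  qed
  have "mallows_prob n q (\<lambda>\<pi>. longest_decreasing n \<pi> < k)
      \<le> mallows_prob n q (\<lambda>\<pi>. \<forall>j\<in>J. \<exists>i\<in>B j. lehmer n \<pi> i \<noteq> t i)"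
  proof (rule mallows_prob_mono[OF assms(1)], intro ballI, rule ccontr)
    fix \<pi> j assume less: "longest_decreasing n \<pi> < k" and j: "j \<in> J"
      and "\<not> (\<exists>i\<in>B j. lehmer n \<pi> i \<noteq> t i)"
    then have "lehmer n \<pi> (Suc (j * k + l)) = k - 1 - l" if "l < k" for l
      using that t unfolding Bimage by auto
    then have "decreasing_on \<pi> (B j)"
      unfolding B_def by (rule decreasing_on_block[OF Bn[OF j]])
    then have "k \<le> longest_decreasing n \<pi>"
      unfolding longest_decreasing_ge_iff using Bsub[OF j] cardB by blast
    then show False using less by simp
  qed
  also have "\<dots> = (\<Sum>c\<in>{c\<in>codes n. \<forall>j\<in>J. \<exists>i\<in>B j. c i \<noteq> t i}. \<Prod>i\<in>{1..n}. q ^ c i) / (\<Prod>i\<in>{1..n}. T i)"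
    unfolding T_def by (rule mallows_prob_lehmer)
  also have "(\<Sum>c\<in>{c\<in>codes n. \<forall>j\<in>J. \<exists>i\<in>B j. c i \<noteq> t i}. \<Prod>i\<in>{1..n}. q ^ c i)
      = (\<Prod>i\<in>{1..n} - \<Union>(B ` J). T i) * (\<Prod>j\<in>J. (\<Prod>i\<in>B j. T i) - (\<Prod>i\<in>B j. q ^ t i))"
    unfolding codes_def T_def
    by (rule sum_PiE_avoiding_blocks) (use Bsub disj tA in \<open>auto simp: J_def\<close>)
  also have "\<dots> \<le> (\<Prod>i\<in>{1..n} - \<Union>(B ` J). T i) * (\<Prod>j\<in>J. (1 - p) * (\<Prod>i\<in>B j. T i))"
    using block block_nonneg T_pos
    by (intro mult_left_mono prod_mono prod_nonneg) (auto intro: less_imp_le)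
  also have "\<dots> = (1 - p) ^ (n div k) * ((\<Prod>i\<in>{1..n} - \<Union>(B ` J). T i) * (\<Prod>j\<in>J. \<Prod>i\<in>B j. T i))"
    by (simp add: prod.distrib J_def)
  \<comment> \<open>The factors of the blocks and of the leftover positions reassemble into the
    normalizing constant, which cancels.\<close>
  also have "(\<Prod>j\<in>J. \<Prod>i\<in>B j. T i) = (\<Prod>i\<in>\<Union>(B ` J). T i)"
    using disj by (intro prod.UNION_disjoint[symmetric]) (auto simp: J_def B_def disjoint_family_on_def)
  also have "(\<Prod>i\<in>{1..n} - \<Union>(B ` J). T i) * (\<Prod>i\<in>\<Union>(B ` J). T i) = (\<Prod>i\<in>{1..n}. T i)"
    by (rule prod.subset_diff[symmetric]) (use Bsub in auto)
  finally show ?thesis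
    using prod_pos[of "{1..n}" T] T_pos by (simp add: p_def divide_right_mono less_imp_neq[symmetric])
qed


section \<open>Asymptotics\<close>

lemma real_choose_two: "real (k choose 2) = real k * (real k - 1) / 2"
  by (induction k) (simp_all add: numeral_2_eq_2 field_simps)

lemma binomial_le_power: "n choose r \<le> n ^ r"
  by (cases "r \<le> n") (simp_all add: binomial_le_pow binomial_eq_0)

text \<open>With \<open>D\<close> of order \<open>ln n\<close>, the number of
  \<open>k\<close>-subsets of a window is at most the exponential of order
  \<open>sqrt (ln n) * ln (ln n)\<close>, whereas above the threshold
  \<open>n * q ^ (k choose 2)\<close> decays like a negative power of \<open>n\<close> up to
  lower-order factors.\<close>

lemma longest_decreasing_upper_tail:
  fixes q \<epsilon> :: real
  assumes "0 < q" "q < 1" "0 < \<epsilon>"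
  shows "(\<lambda>n. mallows_prob n q
    (\<lambda>\<pi>. (1 + \<epsilon>) * sqrt (2 * ln n / ln (1 / q)) < longest_decreasing n \<pi>)) \<longlonglongrightarrow> 0"
proof -
  \<comment> \<open>The threshold is \<open>c * sqrt (ln n)\<close>. The constant \<open>a\<close>
    comes from \<open>2 * D \<le> a * ln n + 2\<close>, \<open>d\<close> from the linear part of
    \<open>k choose 2\<close>, and \<open>\<delta>\<close> is the surplus of the exponent over 1.
    \<open>f\<close> and \<open>g\<close> dominate the two terms of
    \<open>mallows_prob_longest_ge_le\<close>.\<close>
  define \<mu> where "\<mu> = ln (1 / q)"
  define c where "c = (1 + \<epsilon>) * sqrt (2 / \<mu>)"
  define a where "a = 4 / \<mu>"
  define d where "d = \<mu> * c / 2"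
  define \<delta> where "\<delta> = (1 + \<epsilon>)\<^sup>2 - 1"
  define f where "f = (\<lambda>n. 2 * real n * exp (- 2 * ln (real n)))"
  define g where "g = (\<lambda>n. exp ((c * sqrt (ln (real n)) + 1) * ln (a * ln (real n) + 2)
      - \<delta> * ln (real n) + d * sqrt (ln (real n))))"
  have \<mu>: "\<mu> > 0" using assms by (simp add: \<mu>_def)
  have q: "q = exp (- \<mu>)" using assms by (simp add: \<mu>_def ln_div)
  have pow: "q ^ m = exp (- \<mu> * m)" for m
    by (simp add: q mult.commute flip: exp_of_nat_mult)
  have c: "c > 0" and a: "a > 0" using \<mu> assms by (auto simp: c_def a_def)
  then have d: "d > 0" using \<mu> by (simp add: d_def)
  have \<delta>: "\<delta> > 0" using assms by (simp add: \<delta>_def power2_eq_square algebra_simps add_pos_pos)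
  have c2: "\<mu> * c\<^sup>2 = 2 * (1 + \<delta>)"
    using \<mu> by (simp add: c_def \<delta>_def power_mult_distrib)
  have lim: "f \<longlonglongrightarrow> 0" "g \<longlonglongrightarrow> 0"
    using a c d \<delta> unfolding f_def g_def by real_asymp+
  have ev: "\<forall>\<^sub>F n in sequentially. 1 \<le> c * sqrt (ln (real n))"
    using c by real_asymp
  have bound: "mallows_prob n q (\<lambda>\<pi>. (1 + \<epsilon>) * sqrt (2 * ln n / ln (1 / q)) < longest_decreasing n \<pi>)
      \<le> f n + g n" if n: "n \<ge> 2" and x1: "1 \<le> c * sqrt (ln (real n))" for n :: nat
  proof -
    define x where "x = c * sqrt (ln (real n))"
    define k where "k = nat \<lceil>x\<rceil>"
    \<comment> \<open>This makes \<open>q ^ D\<close> at most \<open>1 / n ^ 2\<close>, which beats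
      the factor \<open>n\<close> of the union bound.\<close>
    define D where "D = nat \<lceil>2 * ln n / \<mu>\<rceil>"
    have L: "ln (real n) > 0" using n by simp
    have x: "(1 + \<epsilon>) * sqrt (2 * ln n / ln (1 / q)) = x"
      by (simp add: x_def c_def \<mu>_def real_sqrt_mult real_sqrt_divide)
    have k: "x \<le> k" "k \<le> x + 1" using x1 unfolding k_def x_def by linarith+
    have "k \<ge> 1" using k(1) x1 by (simp add: x_def)
    have "2 * ln n / \<mu> > 0" using L \<mu> by simp
    then have D: "2 * ln n / \<mu> \<le> D" "D \<le> 2 * ln n / \<mu> + 1" "D \<ge> 1"
      unfolding D_def by linarith+
    have "mallows_prob n q (\<lambda>\<pi>. x < longest_decreasing n \<pi>)
        \<le> mallows_prob n q (\<lambda>\<pi>. k \<le> longest_decreasing n \<pi>)"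
      using assms(1) unfolding k_def by (intro mallows_prob_mono) linarith+
    also have "\<dots> \<le> 2 * real n * q ^ D + real n * real (2 * D choose k) * q ^ (k choose 2)"
      using assms(1) \<open>k \<ge> 1\<close> by (rule mallows_prob_longest_ge_le)
    also have "2 * real n * q ^ D \<le> f n"
    proof -
      have "2 * ln n \<le> \<mu> * D" using D(1) \<mu> by (simp add: field_simps)
      then show ?thesis by (simp add: f_def pow mult_left_mono)
    qed
    also have "real n * real (2 * D choose k) * q ^ (k choose 2) \<le> g n"
    proof -
      have "real (2 * D choose k) \<le> real ((2 * D) ^ k)"
        by (simp only: of_nat_le_iff binomial_le_power)
      also have "\<dots> = exp (k * ln (2 * D))"
        using D(3) by (simp add: exp_of_nat_mult)
      also have "\<dots> \<le> exp ((x + 1) * ln (a * ln n + 2))"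
      proof -
        have "2 * real D \<le> a * ln n + 2" using D(2) by (simp add: a_def)
        then have "ln (2 * D) \<le> ln (a * ln n + 2)" using D(3) by simp
        moreover have "0 \<le> ln (2 * D)" using D(3) by simp
        ultimately show ?thesis using k x1 by (simp add: mult_mono x_def)
      qed
      finally have b: "real (2 * D choose k) \<le> exp ((x + 1) * ln (a * ln n + 2))" .
      \<comment> \<open>The assumption \<open>x \<ge> 1\<close>, true for large \<open>n\<close>,
        keeps \<open>x - 1\<close> nonnegative, so the two inequalities may be multiplied.\<close>
      have "x * (x - 1) / 2 \<le> real (k choose 2)"
        unfolding real_choose_two using k(1) x1 by (intro divide_right_mono mult_mono) (auto simp: x_def)
      then have "\<mu> * (x * (x - 1) / 2) \<le> \<mu> * real (k choose 2)"
        using \<mu> by (intro mult_left_mono) auto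
      moreover have "\<mu> * (x * (x - 1) / 2) = (\<mu> * c\<^sup>2) * (sqrt (ln n))\<^sup>2 / 2 - d * sqrt (ln n)"
        by (simp add: x_def d_def power2_eq_square field_simps)
      moreover have "\<dots> = (1 + \<delta>) * ln n - d * sqrt (ln n)"
        using L unfolding c2 by simp
      ultimately have e: "q ^ (k choose 2) \<le> exp (- ((1 + \<delta>) * ln n - d * sqrt (ln n)))"
        by (simp add: pow)
      have "real n * real (2 * D choose k) * q ^ (k choose 2)
          \<le> n * exp ((x + 1) * ln (a * ln n + 2)) * exp (- ((1 + \<delta>) * ln n - d * sqrt (ln n)))"
        using b e assms(1) by (simp add: mult_mono)
      also have "\<dots> = exp (ln n + (x + 1) * ln (a * ln n + 2) + - ((1 + \<delta>) * ln n - d * sqrt (ln n)))"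
        using n by (simp only: exp_add) simp
      \<comment> \<open>The \<open>ln n\<close> from the choice of the window cancels the 1 in
        \<open>1 + \<delta>\<close> and leaves the decay \<open>- \<delta> * ln n\<close>.\<close>
      also have "\<dots> = g n" by (simp add: g_def x_def algebra_simps)
      finally show ?thesis .
    qed
    finally show ?thesis unfolding x by simp
  qed
  show ?thesis
  proof (rule tendsto_sandwich[OF _ _ tendsto_const])
    show "\<forall>\<^sub>F n in sequentially. mallows_prob n q
        (\<lambda>\<pi>. (1 + \<epsilon>) * sqrt (2 * ln n / ln (1 / q)) < longest_decreasing n \<pi>) \<le> f n + g n"
      using ev eventually_ge_at_top[of 2] by eventually_elim (rule bound)
    show "(\<lambda>n. f n + g n) \<longlonglongrightarrow> 0" using tendsto_add[OF lim] by simp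
  qed (auto simp: mallows_prob_nonneg assms(1))
qed

text \<open>For \<open>\<epsilon> < 1\<close>, one block carries the pattern with probability at
  least \<open>n\<close> to the power \<open>- \<beta>\<close>, up to lower-order factors, where
  \<open>\<beta> < 1\<close>. There are about \<open>n / k\<close> blocks with \<open>k\<close> of
  order \<open>sqrt (ln n)\<close>, so the expected number of hits diverges.\<close>

lemma longest_decreasing_lower_tail:
  fixes q \<epsilon> :: real
  assumes "0 < q" "q < 1" "0 < \<epsilon>"
  shows "(\<lambda>n. mallows_prob n q
    (\<lambda>\<pi>. longest_decreasing n \<pi> < (1 - \<epsilon>) * sqrt (2 * ln n / ln (1 / q)))) \<longlonglongrightarrow> 0"
proof (cases "\<epsilon> < 1")
  case False
  \<comment> \<open>For \<open>\<epsilon> \<ge> 1\<close> the threshold is at most 0 and the event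
    is empty.\<close>
  have "(1 - \<epsilon>) * sqrt (2 * ln n / ln (1 / q)) \<le> 0" if "n \<ge> 1" for n :: nat
    using False assms that by (intro mult_nonpos_nonneg) auto
  then have "\<not> real m < (1 - \<epsilon>) * sqrt (2 * ln n / ln (1 / q))" if "n \<ge> 1" for m n :: nat
    using that by (meson not_less of_nat_0_le_iff order.trans)
  then have "mallows_prob n q (\<lambda>\<pi>. longest_decreasing n \<pi> < (1 - \<epsilon>) * sqrt (2 * ln n / ln (1 / q))) = 0"
    if "n \<ge> 1" for n
    using that by (simp add: mallows_prob_def)
  then show ?thesis
    by (intro tendsto_eventually) (auto simp: eventually_at_top_linorder)
next
  case True
  define \<mu> where "\<mu> = ln (1 / q)"
  define c where "c = (1 - \<epsilon>) * sqrt (2 / \<mu>)"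
  \<comment> \<open>\<open>\<nu>\<close> is the cost per position of the factor
    \<open>1 - q\<close>; like the linear part of \<open>k choose 2\<close> it contributes only
    lower-order terms. \<open>h\<close> is the exponential of minus a lower bound for the expected
    number of hits.\<close>
  define \<nu> where "\<nu> = - ln (1 - q)"
  define d where "d = \<nu> * c + \<mu> * c / 2"
  define \<beta> where "\<beta> = (1 - \<epsilon>)\<^sup>2"
  define h where "h = (\<lambda>n. exp (- (exp (- \<beta> * ln (real n) - d * sqrt (ln (real n)) - \<nu>)
    * (real n / (c * sqrt (ln (real n)) + 1) - 1))))"
  have \<mu>: "\<mu> > 0" and \<nu>: "\<nu> > 0" using assms by (auto simp: \<mu>_def \<nu>_def)
  have q: "q = exp (- \<mu>)" using assms by (simp add: \<mu>_def ln_div)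
  have pow: "q ^ m = exp (- \<mu> * m)" for m
    by (simp add: q mult.commute flip: exp_of_nat_mult)
  have q': "1 - q = exp (- \<nu>)" using assms by (simp add: \<nu>_def)
  have pow': "(1 - q) ^ m = exp (- \<nu> * m)" for m
    unfolding q' by (simp add: mult.commute flip: exp_of_nat_mult)
  have c: "c > 0" using \<mu> True by (auto simp: c_def)
  then have d: "d > 0" using \<mu> \<nu> by (simp add: d_def add_pos_pos)
  have \<beta>: "\<beta> > 0" "\<beta> < 1" using True assms by (auto simp: \<beta>_def power_less_one_iff abs_square_less_1)
  have c2: "\<mu> * c\<^sup>2 = 2 * \<beta>"
    using \<mu> by (simp add: c_def \<beta>_def power_mult_distrib)
  have lim: "h \<longlonglongrightarrow> 0"
    using c d \<beta> unfolding h_def by real_asymp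
  have bound: "mallows_prob n q (\<lambda>\<pi>. longest_decreasing n \<pi> < (1 - \<epsilon>) * sqrt (2 * ln n / ln (1 / q))) \<le> h n"
    if n: "n \<ge> 2" for n :: nat
  proof -
    define x where "x = c * sqrt (ln (real n))"
    define k where "k = nat \<lceil>x\<rceil>"
    define p where "p = (1 - q) ^ k * q ^ (k choose 2)"
    define p' where "p' = exp (- \<beta> * ln (real n) - d * sqrt (ln (real n)) - \<nu>)"
    have L: "ln (real n) > 0" using n by simp
    have x: "(1 - \<epsilon>) * sqrt (2 * ln n / ln (1 / q)) = x"
      by (simp add: x_def c_def \<mu>_def real_sqrt_mult real_sqrt_divide)
    have x0: "x > 0" using c L by (simp add: x_def)
    then have k: "x \<le> k" "k \<le> x + 1" "k \<ge> 1" unfolding k_def by linarith+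
    have p: "0 \<le> p" "p \<le> 1"
      using assms unfolding p_def by (auto intro!: mult_le_one power_le_one)
    have "p' \<le> p"
    proof -
      have "real (k choose 2) \<le> (x + 1) * x / 2"
        unfolding real_choose_two using k x0 by (intro divide_right_mono mult_mono) auto
      then have "\<mu> * real (k choose 2) \<le> \<mu> * ((x + 1) * x / 2)"
        using \<mu> by (intro mult_left_mono) auto
      moreover have "\<nu> * k \<le> \<nu> * (x + 1)" using \<nu> k by (intro mult_left_mono) auto
      moreover have "\<nu> * (x + 1) + \<mu> * ((x + 1) * x / 2)
          = (\<mu> * c\<^sup>2) * (sqrt (ln n))\<^sup>2 / 2 + d * sqrt (ln n) + \<nu>"
        by (simp add: x_def d_def power2_eq_square field_simps)
      moreover have "\<dots> = \<beta> * ln n + d * sqrt (ln n) + \<nu>"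
        using L unfolding c2 by simp
      ultimately show ?thesis
        unfolding p_def p'_def pow pow' by (simp flip: exp_add)
    qed
    have m: "real n / (x + 1) - 1 \<le> real (n div k)"
    proof -
      have "real n / (x + 1) \<le> real n / k" using k x0 by (intro divide_left_mono) auto
      also have "\<dots> \<le> real (n div k) + 1"
        using real_of_int_floor_add_one_ge[of "real n / k"] by (simp add: floor_divide_of_nat_eq)
      finally show ?thesis by simp
    qed
    have "mallows_prob n q (\<lambda>\<pi>. longest_decreasing n \<pi> < x)
        \<le> mallows_prob n q (\<lambda>\<pi>. longest_decreasing n \<pi> < k)"
      using assms(1) k(1) by (intro mallows_prob_mono) linarith+
    also have "\<dots> \<le> (1 - p) ^ (n div k)"
      unfolding p_def using assms(1,2) k(3) by (rule mallows_prob_longest_less_le)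
    also have "\<dots> \<le> exp (- p) ^ (n div k)"
      using p exp_ge_add_one_self[of "- p"] by (intro power_mono) auto
    also have "\<dots> = exp (- (p * real (n div k)))"
      by (simp add: mult.commute flip: exp_of_nat_mult)
    also have "\<dots> \<le> exp (- (p' * (real n / (x + 1) - 1)))"
    proof -
      have "p' * (real n / (x + 1) - 1) \<le> p' * real (n div k)"
        using m by (intro mult_left_mono) (auto simp: p'_def)
      also have "\<dots> \<le> p * real (n div k)" using \<open>p' \<le> p\<close> by (intro mult_right_mono) auto
      finally show ?thesis by simp
    qed
    also have "\<dots> = h n" by (simp add: h_def p'_def x_def)
    finally show ?thesis unfolding x .
  qed
  show ?thesis
  proof (rule tendsto_sandwich[OF _ _ tendsto_const lim])
    show "\<forall>\<^sub>F n in sequentially. mallows_prob n q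
        (\<lambda>\<pi>. longest_decreasing n \<pi> < (1 - \<epsilon>) * sqrt (2 * ln n / ln (1 / q))) \<le> h n"
      using eventually_ge_at_top[of 2] by eventually_elim (rule bound)
  qed (auto simp: mallows_prob_nonneg assms(1))
qed

section \<open>Convergence in probability\<close>

theorem theorem2:
  fixes q :: real
    and M :: "nat \<Rightarrow> 'w measure"
    and X :: "nat \<Rightarrow> 'w \<Rightarrow> nat \<Rightarrow> nat"
  assumes "0 < q" and "q < 1"
    and "\<And>n. n \<ge> 1 \<Longrightarrow> mallows_permutation (M n) (X n) n q"
  shows "tendsto_in_prob M
           (\<lambda>n \<omega>. real (longest_decreasing n (X n \<omega>)) * sqrt (ln (1 / q)) / sqrt (2 * ln (real n))) 1"
  unfolding tendsto_in_prob_def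
proof (intro allI impI)
  fix \<epsilon> :: real assume \<epsilon>: "\<epsilon> > 0"
  let ?s = "\<lambda>n. sqrt (2 * ln (real n) / ln (1 / q))"
  let ?Y = "\<lambda>n \<pi>. real (longest_decreasing n \<pi>) * sqrt (ln (1 / q)) / sqrt (2 * ln (real n))"
  let ?U = "\<lambda>n. mallows_prob n q (\<lambda>\<pi>. (1 + \<epsilon>) * ?s n < longest_decreasing n \<pi>)"
  let ?V = "\<lambda>n. mallows_prob n q (\<lambda>\<pi>. longest_decreasing n \<pi> < (1 - \<epsilon>) * ?s n)"
  \<comment> \<open>For \<open>n \<ge> 2\<close> the scale \<open>?s n\<close> is positive, and a
    deviation above \<open>\<epsilon>\<close> puts the length into one of the two tails.\<close>
  have bound: "mallows_prob n q (\<lambda>\<pi>. \<bar>?Y n \<pi> - 1\<bar> > \<epsilon>) \<le> ?U n + ?V n" if "n \<ge> 2" for n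
  proof -
    have s: "?s n > 0" using that assms(1,2) by simp
    have Y: "?Y n \<pi> = longest_decreasing n \<pi> / ?s n" for \<pi>
      by (simp add: real_sqrt_divide)
    have "(1 + \<epsilon>) * ?s n < longest_decreasing n \<pi> \<or> longest_decreasing n \<pi> < (1 - \<epsilon>) * ?s n"
      if "\<bar>?Y n \<pi> - 1\<bar> > \<epsilon>" for \<pi>
    proof -
      from that consider "1 + \<epsilon> < longest_decreasing n \<pi> / ?s n" | "longest_decreasing n \<pi> / ?s n < 1 - \<epsilon>"
        unfolding Y by linarith
      then show ?thesis
        using s by cases (simp_all only: pos_less_divide_eq pos_divide_less_eq simp_thms)
    qed
    then have "mallows_prob n q (\<lambda>\<pi>. \<bar>?Y n \<pi> - 1\<bar> > \<epsilon>)
        \<le> mallows_prob n q (\<lambda>\<pi>. (1 + \<epsilon>) * ?s n < longest_decreasing n \<pi>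
            \<or> longest_decreasing n \<pi> < (1 - \<epsilon>) * ?s n)"
      by (intro mallows_prob_mono[OF assms(1)])
    also have "\<dots> \<le> ?U n + ?V n" using assms(1) by (rule mallows_prob_disj_le)
    finally show ?thesis .
  qed
  have lim: "(\<lambda>n. ?U n + ?V n) \<longlonglongrightarrow> 0"
    using tendsto_add[OF longest_decreasing_upper_tail[OF assms(1,2) \<epsilon>]
      longest_decreasing_lower_tail[OF assms(1,2) \<epsilon>]] by simp
  show "(\<lambda>n. measure (M n) {\<omega> \<in> space (M n). \<bar>?Y n (X n \<omega>) - 1\<bar> > \<epsilon>}) \<longlonglongrightarrow> 0"
  proof (rule tendsto_sandwich[OF _ _ tendsto_const lim])
    show "\<forall>\<^sub>F n in sequentially. measure (M n) {\<omega> \<in> space (M n). \<bar>?Y n (X n \<omega>) - 1\<bar> > \<epsilon>} \<le> ?U n + ?V n"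
      using eventually_ge_at_top[of 2]
    proof eventually_elim
      case (elim n)
      then have "mallows_permutation (M n) (X n) n q" by (intro assms(3)) simp
      from measure_mallows_permutation[OF this, of "\<lambda>\<pi>. \<bar>?Y n \<pi> - 1\<bar> > \<epsilon>"] bound[OF elim]
      show ?case by simp
    qed
  qed simp
qed

end
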